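(* Let $\beta>0$, $h\ge 0$, and assume $\beta<\beta_c:=\rho(\Delta^2\Lambda)^{-1/2}$. Then the set $$\mathcal C(\beta,h)=\Big\{\mathbf q=(q_1,\dots,q_m)^{\top}\in[0,1]^m:\ q_s=\mathbb E\tanh^2\big(\beta\eta\sqrt{(\Delta^2\Lambda\mathbf q)_s}+h\big)\ \text{for } s=1,\dots,m\Big\},\qquad \eta\sim N(0,1),$$ is a singleton; i.e. the system $q_s=\mathbb E\tanh^2(\beta\eta\sqrt{(\Delta^2\Lambda\mathbf q)_s}+h)$, $s=1,\dots,m$, has a unique solution.
   Context: $m\ge 2$ is an integer. $\Delta^2=(\Delta^2_{s,t})_{s,t=1}^m$ is a symmetric, invertible, nonzero $m\times m$ real matrix with non-negative entries (not necessarily positive-definite; $\Delta^2_{s,t}$ is just notation for the $(s,t)$ entry). $\Lambda=\mathrm{diag}(\lambda_1,\dots,\lambda_m)$ with $\lambda_s\in(0,1)$ and $\sum_s\lambda_s=1$. $\rho(A)$ denotes the spectral radius of $A$ (largest absolute value of its eigenvalues). *)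

theory Defs
  imports "HOL-Probability.Probability" "Jordan_Normal_Form.Spectral_Radius"
begin

unbundle no vec_syntax

text \<open>Matrix and vector indices run over \<open>{0..<m}\<close> instead of \<open>{1..m}\<close>.
  The library's spectral radius is defined for complex matrices (it ranges over all complex
  eigenvalues), so the real matrix is embedded.\<close>

definition beta_c :: "nat \<Rightarrow> real mat \<Rightarrow> (nat \<Rightarrow> real) \<Rightarrow> real" where
  "beta_c m Dsq lam =
     spectral_radius (map_mat complex_of_real (Dsq * mat_diag m lam)) powr (- 1 / 2)"

definition crit_points ::
  "nat \<Rightarrow> 'a measure \<Rightarrow> ('a \<Rightarrow> real) \<Rightarrow> real mat \<Rightarrow> (nat \<Rightarrow> real) \<Rightarrow> real \<Rightarrow> real \<Rightarrow> real vec set" where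
  "crit_points m M eta Dsq lam \<beta> h =
     {q \<in> carrier_vec m.
        (\<forall>s<m. q $ s \<in> {0..1}) \<and>
        (\<forall>s<m. q $ s =
           prob_space.expectation M
             (\<lambda>\<omega>. (tanh (\<beta> * eta \<omega> * sqrt (((Dsq * mat_diag m lam) *\<^sub>v q) $ s) + h))\<^sup>2))}"

end

theory Submission
  imports Defs
begin

text \<open>
  Write \<open>A = \<Delta>\<^sup>2 \<Lambda>\<close>, \<open>B = \<beta>\<^sup>2 A\<close> and \<open>G x = E tanh\<^sup>2 (\<eta> \<surd>x + h)\<close>. The critical points are the
  fixed points in the cube \<open>[0,1]\<^sup>m\<close> of the map \<open>F\<close> with \<open>(F q)\<^sub>s = G ((B q)\<^sub>s)\<close>. Two facts make this
  map a contraction in a suitable sense.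

  First, \<open>G\<close> is 1-Lipschitz on \<open>[0,\<infinity>)\<close>, although \<open>x \<mapsto> \<surd>x\<close> is not Lipschitz at \<open>0\<close>
  (\<open>gaussian_smoothing_lipschitz_variance\<close>). For \<open>x \<le> y\<close>, a Gaussian of variance \<open>y\<close> is one of
  variance \<open>x\<close> plus an independent one of variance \<open>y - x\<close>. In the second-order Taylor expansion of
  \<open>tanh\<^sup>2\<close> with respect to the added noise the linear term has mean zero, so the expectation changes by
  at most \<open>(y - x) sup \<bar>(tanh\<^sup>2)''\<bar> / 2\<close>, and \<open>\<bar>(tanh\<^sup>2)''\<bar> \<le> 2\<close>. Since the entries of \<open>B\<close> are
  non-negative, \<open>\<bar>F p - F q\<bar> \<le> B \<bar>p - q\<bar>\<close> holds componentwise.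

  Second, \<open>\<beta> < \<beta>\<^sub>c\<close> ensures that \<open>B\<close> has spectral radius below \<open>1\<close>, so the entries of \<open>B\<^sup>n\<close>
  decay geometrically (\<open>pow_mat_entry_geometric_bound\<close>). Iterating the componentwise estimate shows
  that any two orbits of \<open>F\<close> in the cube approach each other geometrically. Comparing two fixed points
  gives uniqueness; comparing an orbit with its own shift shows that it converges, and the limit is a
  fixed point (\<open>ex1_fixpoint_unit_cube\<close>).
\<close>

section \<open>Powers of matrices with spectral radius below one\<close>

lemma smult_mat_mult_vec:
  fixes A :: "'a::comm_semiring_1 mat"
  assumes "A \<in> carrier_mat n n" "v \<in> carrier_vec n"
  shows "(c \<cdot>\<^sub>m A) *\<^sub>v v = c \<cdot>\<^sub>v (A *\<^sub>v v)"
  using assms by (intro eq_vecI) (auto simp: scalar_prod_def sum_distrib_left mult.assoc)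

lemma spectral_radius_smult_le:
  fixes A :: "complex mat"
  assumes A: "A \<in> carrier_mat n n" and n: "n > 0" and c: "c \<noteq> 0"
  shows "spectral_radius (c \<cdot>\<^sub>m A) \<le> norm c * spectral_radius A"
proof -
  have cA: "c \<cdot>\<^sub>m A \<in> carrier_mat n n" using A by simp
  from spectral_radius_mem_max(1)[OF cA n] obtain ev where
    ev: "eigenvalue (c \<cdot>\<^sub>m A) ev" and sr: "spectral_radius (c \<cdot>\<^sub>m A) = norm ev"
    by (auto simp: spectrum_def)
  from ev obtain v where v: "v \<in> carrier_vec n" "v \<noteq> 0\<^sub>v n"
    and eq: "(c \<cdot>\<^sub>m A) *\<^sub>v v = ev \<cdot>\<^sub>v v"
    using A by (auto simp: eigenvalue_def eigenvector_def)
  have "c \<cdot>\<^sub>v (A *\<^sub>v v) = ev \<cdot>\<^sub>v v"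
    using eq A v(1) by (simp add: smult_mat_mult_vec[OF A])
  then have "(inverse c) \<cdot>\<^sub>v (c \<cdot>\<^sub>v (A *\<^sub>v v)) = (inverse c) \<cdot>\<^sub>v (ev \<cdot>\<^sub>v v)"
    by simp
  then have "A *\<^sub>v v = (ev / c) \<cdot>\<^sub>v v"
    using c by (simp add: smult_smult_assoc field_simps)
  then have "eigenvalue A (ev / c)"
    using v A by (auto simp: eigenvalue_def eigenvector_def)
  then have "norm (ev / c) \<le> spectral_radius A"
    by (intro spectral_radius_mem_max(2)[OF A n]) (auto simp: spectrum_def)
  then show ?thesis using c unfolding sr
    by (simp add: norm_divide divide_simps mult.commute)
qed

lemma smult_pow_mat:
  fixes A :: "'a::comm_semiring_1 mat"
  assumes A: "A \<in> carrier_mat n n"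
  shows "(c \<cdot>\<^sub>m A) ^\<^sub>m k = c ^ k \<cdot>\<^sub>m (A ^\<^sub>m k)"
proof (induction k)
  case 0
  show ?case by (rule eq_matI) auto
next
  case (Suc k)
  have Ak: "A ^\<^sub>m k \<in> carrier_mat n n" using A by simp
  show ?case
    by (simp add: Suc) (rule eq_matI; insert A Ak; auto simp: scalar_prod_def sum_distrib_left ac_simps)
qed

lemma pow_mat_Suc_left:
  fixes A :: "'a::semiring_1 mat"
  assumes A: "A \<in> carrier_mat n n"
  shows "A ^\<^sub>m Suc k = A * A ^\<^sub>m k"
proof (induction k)
  case 0
  show ?case using A by simp
next
  case (Suc k)
  have "A ^\<^sub>m Suc (Suc k) = (A * A ^\<^sub>m k) * A" using Suc by simp
  also have "\<dots> = A * (A ^\<^sub>m k * A)" using A by (intro assoc_mult_mat) auto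
  finally show ?case by simp
qed

text \<open>Choose \<open>\<theta>\<close> strictly between the spectral radius and \<open>1\<close>. Then \<open>B / \<theta>\<close> still has spectral radius
  below \<open>1\<close>, so by the Jordan normal form its powers are bounded.\<close>
lemma pow_mat_entry_geometric_bound:
  fixes B :: "real mat"
  assumes B: "B \<in> carrier_mat n n" and n: "n > 0"
    and sr: "spectral_radius (map_mat complex_of_real B) < 1"
  obtains C \<theta> where "0 < \<theta>" "\<theta> < 1"
    "\<And>k i j. i < n \<Longrightarrow> j < n \<Longrightarrow> \<bar>(B ^\<^sub>m k) $$ (i, j)\<bar> \<le> C * \<theta> ^ k"
proof -
  let ?B = "map_mat complex_of_real B"
  have B': "?B \<in> carrier_mat n n" using B by simp
  have "0 \<le> spectral_radius ?B" using spectral_radius_mem_max(1)[OF B' n] by auto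
  with sr obtain \<theta> where \<theta>: "spectral_radius ?B < \<theta>" "\<theta> < 1" "0 < \<theta>"
    by (meson dense le_less_trans)
  let ?D = "complex_of_real (inverse \<theta>) \<cdot>\<^sub>m ?B"
  have D: "?D \<in> carrier_mat n n" using B by simp
  have "spectral_radius ?D \<le> norm (complex_of_real (inverse \<theta>)) * spectral_radius ?B"
    using \<theta> by (intro spectral_radius_smult_le[OF B' n]) auto
  also have "\<dots> < 1" using \<theta> by (simp only: norm_of_real) (simp add: field_simps)
  finally obtain C where C: "\<And>k. norm_bound (?D ^\<^sub>m k) C"
    using spectral_radius_jnf_norm_bound_less_1_upper_triangular[OF D] by blast
  have "\<bar>(B ^\<^sub>m k) $$ (i, j)\<bar> \<le> C * \<theta> ^ k" if ij: "i < n" "j < n" for k i j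
  proof -
    have "?D = map_mat complex_of_real (inverse \<theta> \<cdot>\<^sub>m B)"
      by (rule eq_matI) auto
    then have "?D ^\<^sub>m k = map_mat complex_of_real ((inverse \<theta> \<cdot>\<^sub>m B) ^\<^sub>m k)"
      using B by (simp add: of_real_hom.mat_hom_pow[of "inverse \<theta> \<cdot>\<^sub>m B" n])
    moreover have "(inverse \<theta> \<cdot>\<^sub>m B) ^\<^sub>m k = inverse \<theta> ^ k \<cdot>\<^sub>m (B ^\<^sub>m k)"
      using B by (rule smult_pow_mat)
    ultimately have "\<bar>inverse \<theta> ^ k * (B ^\<^sub>m k) $$ (i, j)\<bar> \<le> C"
      using C[of k] ij B unfolding norm_bound_def by (auto simp: norm_mult norm_power abs_mult norm_inverse power_abs)
    then show ?thesis using \<theta>(3)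
      by (simp add: abs_mult power_abs field_simps)
  qed
  with \<theta> that show ?thesis by blast
qed

text \<open>A scalar recursion \<open>w (n + 1) \<le> b w n\<close> gives \<open>w n \<le> b\<^sup>n w 0\<close>; for vectors the same induction needs
  \<open>B\<close> to be monotone, that is, to have non-negative entries.\<close>
lemma dominated_by_matrix_powers:
  fixes B :: "real mat" and w :: "nat \<Rightarrow> nat \<Rightarrow> real"
  assumes B: "B \<in> carrier_mat m m"
    and nonneg: "\<And>s t. s < m \<Longrightarrow> t < m \<Longrightarrow> 0 \<le> B $$ (s, t)"
    and step: "\<And>n s. s < m \<Longrightarrow> w (Suc n) s \<le> (\<Sum>t<m. B $$ (s, t) * w n t)"
    and s: "s < m"
  shows "w n s \<le> (\<Sum>t<m. (B ^\<^sub>m n) $$ (s, t) * w 0 t)"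
  using s
proof (induction n arbitrary: s)
  case 0
  have "(\<Sum>t<m. (B ^\<^sub>m 0) $$ (s, t) * w 0 t) = (\<Sum>t<m. if s = t then w 0 t else 0)"
    using B 0 by (intro sum.cong) auto
  also have "\<dots> = w 0 s" using 0 by simp
  finally show ?case by simp
next
  case (Suc n)
  have Bn: "B ^\<^sub>m n \<in> carrier_mat m m" using B by simp
  have "w (Suc n) s \<le> (\<Sum>t<m. B $$ (s, t) * w n t)"
    using Suc.prems by (rule step)
  also have "\<dots> \<le> (\<Sum>t<m. B $$ (s, t) * (\<Sum>u<m. (B ^\<^sub>m n) $$ (t, u) * w 0 u))"
    using Suc.prems by (intro sum_mono mult_left_mono Suc.IH nonneg) auto
  also have "\<dots> = (\<Sum>u<m. (\<Sum>t<m. B $$ (s, t) * (B ^\<^sub>m n) $$ (t, u)) * w 0 u)"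
    unfolding sum_distrib_left sum_distrib_right
    by (subst sum.swap) (simp add: mult.assoc)
  also have "\<dots> = (\<Sum>u<m. (B * B ^\<^sub>m n) $$ (s, u) * w 0 u)"
    using Suc.prems B Bn
    by (intro sum.cong refl) (auto simp: scalar_prod_def atLeast0LessThan)
  also have "B * B ^\<^sub>m n = B ^\<^sub>m Suc n"
    using pow_mat_Suc_left[OF B] by simp
  finally show ?case .
qed

section \<open>Fixed points of componentwise contractions\<close>

definition unit_cube :: "nat \<Rightarrow> real vec set" where
  "unit_cube m = {q \<in> carrier_vec m. \<forall>s<m. q $ s \<in> {0..1}}"

text \<open>A single step of \<open>F\<close> may increase the maximum distance, since row sums of \<open>B\<close> can exceed \<open>1\<close>;
  but the componentwise estimate can be iterated, and \<open>B\<^sup>n \<rightarrow> 0\<close> geometrically.\<close>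
lemma ex1_fixpoint_unit_cube:
  fixes F :: "real vec \<Rightarrow> real vec" and B :: "real mat"
  assumes B: "B \<in> carrier_mat m m" and m: "m > 0"
    and nonneg: "\<And>s t. s < m \<Longrightarrow> t < m \<Longrightarrow> 0 \<le> B $$ (s, t)"
    and sr: "spectral_radius (map_mat complex_of_real B) < 1"
    and F: "\<And>q. q \<in> unit_cube m \<Longrightarrow> F q \<in> unit_cube m"
    and lip: "\<And>p q s. p \<in> unit_cube m \<Longrightarrow> q \<in> unit_cube m \<Longrightarrow> s < m \<Longrightarrow>
       \<bar>F p $ s - F q $ s\<bar> \<le> (\<Sum>t<m. B $$ (s, t) * \<bar>p $ t - q $ t\<bar>)"
  shows "\<exists>!q. q \<in> unit_cube m \<and> F q = q"
proof -
  obtain C \<theta> where \<theta>: "0 < \<theta>" "\<theta> < 1"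
    and C: "\<And>k i j. i < m \<Longrightarrow> j < m \<Longrightarrow> \<bar>(B ^\<^sub>m k) $$ (i, j)\<bar> \<le> C * \<theta> ^ k"
    by (rule pow_mat_entry_geometric_bound[OF B m sr]) blast
  \<comment> \<open>One estimate for two orbits serves both parts: constant orbits give uniqueness, and an orbit
    together with its shift gives a Cauchy sequence.\<close>
  have decay: "\<bar>p n $ s - q n $ s\<bar> \<le> real m * C * \<theta> ^ n"
    if cube: "\<And>n. p n \<in> unit_cube m" "\<And>n. q n \<in> unit_cube m"
      and orbit: "\<And>n. p (Suc n) = F (p n)" "\<And>n. q (Suc n) = F (q n)" and s: "s < m"
    for p q :: "nat \<Rightarrow> real vec" and n s
  proof -
    have "\<bar>p n $ s - q n $ s\<bar> \<le> (\<Sum>t<m. (B ^\<^sub>m n) $$ (s, t) * \<bar>p 0 $ t - q 0 $ t\<bar>)"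
      by (rule dominated_by_matrix_powers[where w = "\<lambda>n s. \<bar>p n $ s - q n $ s\<bar>", OF B nonneg _ s])
        (auto simp: orbit intro: lip cube)
    also have "\<dots> \<le> (\<Sum>t<m. C * \<theta> ^ n)"
    proof (rule sum_mono)
      fix t assume t: "t \<in> {..<m}"
      have "p 0 $ t \<in> {0..1}" "q 0 $ t \<in> {0..1}"
        using cube[of 0] t by (auto simp: unit_cube_def)
      then have "\<bar>p 0 $ t - q 0 $ t\<bar> \<le> 1" by auto
      then have "\<bar>(B ^\<^sub>m n) $$ (s, t)\<bar> * \<bar>p 0 $ t - q 0 $ t\<bar> \<le> C * \<theta> ^ n * 1"
        using C[OF s, of t n] t by (intro mult_mono) (auto intro: order_trans[OF abs_ge_zero])
      then show "(B ^\<^sub>m n) $$ (s, t) * \<bar>p 0 $ t - q 0 $ t\<bar> \<le> C * \<theta> ^ n"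
        by (smt (verit) abs_ge_self mult_right_mono abs_ge_zero)
    qed
    finally show ?thesis by (simp add: mult.assoc)
  qed
  have null: "(\<lambda>n. real m * C * \<theta> ^ n) \<longlonglongrightarrow> 0"
    using \<theta> by (intro tendsto_mult_right_zero LIMSEQ_power_zero) auto
  have unique: "p = q" if "p \<in> unit_cube m" "F p = p" "q \<in> unit_cube m" "F q = q" for p q
  proof (rule eq_vecI)
    show "dim_vec p = dim_vec q" using that by (auto simp: unit_cube_def)
    fix s assume "s < dim_vec q"
    then have s: "s < m" using that by (auto simp: unit_cube_def)
    have "\<bar>p $ s - q $ s\<bar> \<le> real m * C * \<theta> ^ n" for n
      using decay[of "\<lambda>_. p" "\<lambda>_. q" s n] that s by simp
    then have "\<bar>p $ s - q $ s\<bar> \<le> 0"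
      by (intro LIMSEQ_le_const[OF null]) auto
    then show "p $ s = q $ s" by simp
  qed
  define x where "x n = (F ^^ n) (0\<^sub>v m)" for n
  have x_Suc: "x (Suc n) = F (x n)" for n by (simp add: x_def)
  have x_cube: "x n \<in> unit_cube m" for n
  proof (induction n)
    case 0
    show ?case by (simp add: x_def unit_cube_def)
  qed (simp add: x_Suc F)
  have "convergent (\<lambda>n. x n $ s)" if s: "s < m" for s
  proof -
    have "summable (\<lambda>n. x (Suc n) $ s - x n $ s)"
    proof (rule summable_comparison_test')
      show "summable (\<lambda>n. real m * C * \<theta> ^ n)"
        using \<theta> by (intro summable_mult summable_geometric) auto
      show "norm (x (Suc n) $ s - x n $ s) \<le> real m * C * \<theta> ^ n" if "n \<ge> 0" for n
        unfolding real_norm_def by (rule decay[of "\<lambda>n. x (Suc n)" x, OF x_cube x_cube x_Suc x_Suc s])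
    qed
    then have "convergent (\<lambda>n. x n $ s - x 0 $ s)"
      by (simp add: summable_iff_convergent sum_lessThan_telescope[of "\<lambda>n. x n $ s"])
    from convergent_add[OF this convergent_const[of "x 0 $ s"]] show ?thesis by simp
  qed
  then obtain l where l: "\<And>s. s < m \<Longrightarrow> (\<lambda>n. x n $ s) \<longlonglongrightarrow> l s"
    unfolding convergent_def by metis
  define q where "q = vec m l"
  have q_lim: "(\<lambda>n. x n $ s) \<longlonglongrightarrow> q $ s" if "s < m" for s
    using l that by (simp add: q_def)
  have q: "q \<in> unit_cube m"
  proof -
    have "q $ s \<in> {0..1}" if s: "s < m" for s
      by (rule Lim_in_closed_set[OF closed_atLeastAtMost _ _ q_lim[OF s]])
        (use x_cube s in \<open>auto simp: unit_cube_def\<close>)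
    then show ?thesis by (simp add: unit_cube_def q_def)
  qed
  have "F q = q"
  proof (rule eq_vecI)
    show "dim_vec (F q) = dim_vec q" using F[OF q] q by (auto simp: unit_cube_def)
    fix s assume "s < dim_vec q"
    then have s: "s < m" by (simp add: q_def)
    have "(\<lambda>n. \<Sum>t<m. B $$ (s, t) * \<bar>x n $ t - q $ t\<bar>) \<longlonglongrightarrow> (\<Sum>t<m. B $$ (s, t) * \<bar>q $ t - q $ t\<bar>)"
      by (intro tendsto_intros q_lim) auto
    then have "(\<lambda>n. \<Sum>t<m. B $$ (s, t) * \<bar>x n $ t - q $ t\<bar>) \<longlonglongrightarrow> 0"
      by simp
    then have "(\<lambda>n. F (x n) $ s - F q $ s) \<longlonglongrightarrow> 0"
      by (rule Lim_null_comparison[rotated]) (use lip[OF x_cube q s] in auto)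
    then have "(\<lambda>n. x (Suc n) $ s) \<longlonglongrightarrow> F q $ s"
      by (simp add: x_Suc Lim_null[symmetric])
    then show "F q $ s = q $ s"
      using LIMSEQ_unique LIMSEQ_Suc[OF q_lim[OF s]] by blast
  qed
  with q unique show ?thesis by blast
qed

section \<open>Gaussian smoothing\<close>

abbreviation std_normal :: "real measure" where
  "std_normal \<equiv> density lborel std_normal_density"

interpretation std_normal: prob_space std_normal
  by (rule prob_space_normal_density) simp

interpretation std_normal_pair: pair_prob_space std_normal std_normal ..

lemma distr_pair_std_normal_snd: "distr (std_normal \<Otimes>\<^sub>M std_normal) std_normal snd = std_normal"
proof -
  have "distr (std_normal \<Otimes>\<^sub>M std_normal) std_normal snd =
    distr (distr (std_normal \<Otimes>\<^sub>M std_normal) (std_normal \<Otimes>\<^sub>M std_normal) (\<lambda>(x, y). (y, x))) std_normal snd"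
    using std_normal_pair.distr_pair_swap by simp
  also have "\<dots> = distr (std_normal \<Otimes>\<^sub>M std_normal) std_normal fst"
    by (subst distr_distr) (auto simp: comp_def case_prod_unfold)
  finally show ?thesis by (simp add: std_normal.distr_pair_fst)
qed

text \<open>In law, \<open>\<tau> X + \<delta> Y\<close> is \<open>\<surd>(\<tau>\<^sup>2 + \<delta>\<^sup>2) Z\<close> for independent standard normal \<open>X\<close>, \<open>Y\<close>. The
  sum rule for independent normals asks for positive standard deviations; here a zero one is allowed as
  well, which is what makes the Lipschitz bound below reach down to variance \<open>0\<close>.\<close>
lemma std_normal_convolution:
  fixes f :: "real \<Rightarrow> real"
  assumes f[measurable]: "f \<in> borel_measurable borel" and bdd: "\<And>x. \<bar>f x\<bar> \<le> K"
    and \<tau>: "0 \<le> \<tau>" and \<delta>: "0 \<le> \<delta>"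
  shows "(\<integral>x. (\<integral>y. f (\<tau> * x + \<delta> * y) \<partial>std_normal) \<partial>std_normal)
       = (\<integral>z. f (sqrt (\<tau>\<^sup>2 + \<delta>\<^sup>2) * z) \<partial>std_normal)"
proof -
  consider "\<tau> = 0" | "\<delta> = 0" | "0 < \<tau>" "0 < \<delta>" using \<tau> \<delta> by fastforce
  then show ?thesis
  proof cases
    case 1
    then show ?thesis using \<delta> std_normal.prob_space by simp
  next
    case 2
    then show ?thesis using \<tau> std_normal.prob_space by simp
  next
    case 3
    let ?P = "std_normal \<Otimes>\<^sub>M std_normal"
    have s: "sets std_normal = sets borel" by simp
    have fst': "distr ?P borel fst = std_normal"
      using std_normal.distr_pair_fst[of std_normal] s distr_cong[OF refl s, of ?P fst fst] by simp
    have snd': "distr ?P borel snd = std_normal"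
      using distr_pair_std_normal_snd distr_cong[OF refl s, of ?P snd snd] by simp
    have DX: "distributed ?P lborel fst std_normal_density"
      using fst' by (simp add: distributed_def distr_cong[OF refl sets_lborel])
    have DY: "distributed ?P lborel snd std_normal_density"
      using snd' by (simp add: distributed_def distr_cong[OF refl sets_lborel])
    have "std_normal_pair.P.indep_var borel fst borel snd"
      unfolding std_normal_pair.P.indep_var_distribution_eq fst' snd'
      by (auto intro!: distr_id2[symmetric] sets_pair_measure_cong)
    then have ind: "std_normal_pair.P.indep_var borel (\<lambda>\<omega>. \<tau> * fst \<omega>) borel (\<lambda>\<omega>. \<delta> * snd \<omega>)"
      using std_normal_pair.P.indep_var_compose[of borel fst borel snd "\<lambda>x. \<tau> * x" borel "\<lambda>x. \<delta> * x" borel]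
      by (simp add: comp_def)
    have "distributed ?P lborel (\<lambda>\<omega>. \<tau> * fst \<omega>) (normal_density 0 \<tau>)"
      "distributed ?P lborel (\<lambda>\<omega>. \<delta> * snd \<omega>) (normal_density 0 \<delta>)"
      using std_normal_pair.P.normal_density_affine[OF DX, of \<tau> 0] std_normal_pair.P.normal_density_affine[OF DY, of \<delta> 0] 3 by simp_all
    from std_normal_pair.P.add_indep_normal[OF ind 3 this]
    have D1: "distributed ?P lborel (\<lambda>\<omega>. \<tau> * fst \<omega> + \<delta> * snd \<omega>) (normal_density 0 (sqrt (\<tau>\<^sup>2 + \<delta>\<^sup>2)))"
      by simp
    have "distributed std_normal lborel (\<lambda>x. x) std_normal_density"
      by (auto simp: distributed_def intro!: distr_id2)
    from std_normal.normal_density_affine[OF this, of "sqrt (\<tau>\<^sup>2 + \<delta>\<^sup>2)" 0] 3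
    have D2: "distributed std_normal lborel (\<lambda>z. sqrt (\<tau>\<^sup>2 + \<delta>\<^sup>2) * z) (normal_density 0 (sqrt (\<tau>\<^sup>2 + \<delta>\<^sup>2)))"
      by (simp add: add_pos_pos)
    have "integrable ?P (\<lambda>\<omega>. f (\<tau> * fst \<omega> + \<delta> * snd \<omega>))"
      by (rule std_normal_pair.P.integrable_const_bound[of _ K]) (auto simp: bdd)
    then have "(\<integral>x. (\<integral>y. f (\<tau> * x + \<delta> * y) \<partial>std_normal) \<partial>std_normal)
       = (\<integral>\<omega>. f (\<tau> * fst \<omega> + \<delta> * snd \<omega>) \<partial>?P)"
      by (subst std_normal_pair.integral_fst'[symmetric]) auto
    also have "\<dots> = (\<integral>z. f (sqrt (\<tau>\<^sup>2 + \<delta>\<^sup>2) * z) \<partial>std_normal)"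
      using distributed_integral[OF D1, of f] distributed_integral[OF D2, of f] by simp
    finally show ?thesis .
  qed
qed

lemma std_normal_linear_moment: "integrable std_normal (\<lambda>x. x)" "(\<integral>x. x \<partial>std_normal) = 0"
  using std_normal_moment_odd[of 0]
  by (auto simp: integrable_density integral_density has_bochner_integral_iff)

lemma std_normal_second_moment: "integrable std_normal (\<lambda>x. x\<^sup>2)" "(\<integral>x. x\<^sup>2 \<partial>std_normal) = 1"
  using std_normal_moment_even[of 1]
  by (auto simp: integrable_density integral_density has_bochner_integral_iff)

text \<open>Integrating the Taylor bound against the noise: the linear term \<open>d \<delta> y\<close> has mean zero and the
  error term \<open>L \<delta>\<^sup>2 y\<^sup>2\<close> has mean \<open>L \<delta>\<^sup>2\<close>.\<close>
lemma std_normal_smoothing_error: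
  fixes f :: "real \<Rightarrow> real"
  assumes f[measurable]: "f \<in> borel_measurable borel" and bdd: "\<And>x. \<bar>f x\<bar> \<le> K"
    and taylor: "\<And>u. \<bar>f (a + u) - f a - d * u\<bar> \<le> L * u\<^sup>2"
  shows "\<bar>(\<integral>y. f (a + \<delta> * y) \<partial>std_normal) - f a\<bar> \<le> L * \<delta>\<^sup>2"
proof -
  have int: "integrable std_normal (\<lambda>y. f (a + \<delta> * y))"
    by (rule std_normal.integrable_const_bound[of _ K]) (auto simp: bdd)
  have "(\<integral>y. f (a + \<delta> * y) \<partial>std_normal) - f a
    = (\<integral>y. f (a + \<delta> * y) - f a - d * (\<delta> * y) \<partial>std_normal)"
    using int std_normal_linear_moment std_normal.prob_space by simp
  also have "\<bar>\<dots>\<bar> \<le> (\<integral>y. L * \<delta>\<^sup>2 * y\<^sup>2 \<partial>std_normal)"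
    unfolding real_norm_def[symmetric]
  proof (rule Bochner_Integration.integral_norm_bound_integral)
    show "norm (f (a + \<delta> * y) - f a - d * (\<delta> * y)) \<le> L * \<delta>\<^sup>2 * y\<^sup>2" for y
      using taylor[of "\<delta> * y"] by (simp add: power_mult_distrib mult.assoc)
  qed (use int std_normal_linear_moment std_normal_second_moment in auto)
  also have "\<dots> = L * \<delta>\<^sup>2" using std_normal_second_moment by simp
  finally show ?thesis .
qed

text \<open>The bound is linear in the variance, not in the standard deviation: the larger variance is reached
  from the smaller one by adding independent noise of variance \<open>y - x\<close>, and the smoothing error is
  applied conditionally on the original Gaussian variable.\<close>
lemma gaussian_smoothing_lipschitz_variance:
  fixes f f' :: "real \<Rightarrow> real"
  assumes f[measurable]: "f \<in> borel_measurable borel" and bdd: "\<And>x. \<bar>f x\<bar> \<le> K"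
    and taylor: "\<And>a u. \<bar>f (a + u) - f a - f' a * u\<bar> \<le> L * u\<^sup>2"
    and x: "0 \<le> x" and y: "0 \<le> y"
  shows "\<bar>(\<integral>z. f (sqrt x * z + h) \<partial>std_normal) - (\<integral>z. f (sqrt y * z + h) \<partial>std_normal)\<bar> \<le> L * \<bar>x - y\<bar>"
  using x y
proof (induction x y rule: linorder_wlog)
  case (sym x y)
  then show ?case by (simp add: abs_minus_commute)
next
  case (le x y)
  have int: "integrable std_normal (\<lambda>z. f (sqrt x * z + h))"
    by (rule std_normal.integrable_const_bound[of _ K]) (auto simp: bdd)
  \<comment> \<open>\<open>g z\<close> is the conditional expectation given that the Gaussian of variance \<open>x\<close> takes the value
    \<open>\<surd>x z\<close>.\<close>
  define g where "g = (\<lambda>z. \<integral>w. f (sqrt x * z + h + sqrt (y - x) * w) \<partial>std_normal)"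
  have err: "\<bar>g z - f (sqrt x * z + h)\<bar> \<le> L * (y - x)" for z
    using std_normal_smoothing_error[OF f bdd taylor, of "sqrt x * z + h" "sqrt (y - x)"] le
    by (simp add: g_def)
  have intg: "integrable std_normal g"
  proof (rule std_normal.integrable_const_bound[of _ "K + L * (y - x)"])
    show "AE z in std_normal. norm (g z) \<le> K + L * (y - x)"
      using err bdd by (intro AE_I2) (smt (verit) real_norm_def)
    show "g \<in> borel_measurable std_normal" unfolding g_def by measurable
  qed
  have "(\<integral>z. f (sqrt y * z + h) \<partial>std_normal) = (\<integral>z. g z \<partial>std_normal)"
    using std_normal_convolution[of "\<lambda>v. f (v + h)" K "sqrt x" "sqrt (y - x)"] bdd le
    by (simp add: g_def ac_simps)
  then have "\<bar>(\<integral>z. f (sqrt x * z + h) \<partial>std_normal) - (\<integral>z. f (sqrt y * z + h) \<partial>std_normal)\<bar>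
     = \<bar>\<integral>z. g z - f (sqrt x * z + h) \<partial>std_normal\<bar>"
    using int intg by (simp add: abs_minus_commute)
  also have "\<dots> \<le> (\<integral>z. L * (y - x) \<partial>std_normal)"
    unfolding real_norm_def[symmetric]
    by (rule Bochner_Integration.integral_norm_bound_integral) (use err int intg in auto)
  also have "\<dots> = L * \<bar>x - y\<bar>" using le std_normal.prob_space by simp
  finally show ?case .
qed

lemma taylor_quadratic_bound:
  fixes f f' f'' :: "real \<Rightarrow> real"
  assumes f: "\<And>x. (f has_real_derivative f' x) (at x)"
    and f': "\<And>x. (f' has_real_derivative f'' x) (at x)"
    and b: "\<And>x. \<bar>f'' x\<bar> \<le> 2 * L"
  shows "\<bar>f (a + u) - f a - f' a * u\<bar> \<le> L * u\<^sup>2"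
proof (cases "u = 0")
  case False
  define diff where "diff = (\<lambda>n::nat. if n = 0 then f else if n = 1 then f' else f'')"
  have "\<exists>t. (if a + u < a then a + u < t \<and> t < a else a < t \<and> t < a + u) \<and>
       f (a + u) = (\<Sum>m<2. diff m a / fact m * (a + u - a) ^ m) + diff 2 t / fact 2 * (a + u - a) ^ 2"
    using f f' False
    by (intro Taylor[where a = "min a (a+u)" and b = "max a (a+u)"]) (auto simp: diff_def less_2_cases_iff)
  then obtain t where "f (a + u) = f a + f' a * u + f'' t / 2 * u\<^sup>2"
    by (auto simp: diff_def eval_nat_numeral)
  then have "\<bar>f (a + u) - f a - f' a * u\<bar> = (\<bar>f'' t\<bar> / 2) * u\<^sup>2"
    by (simp add: abs_mult)
  also have "\<dots> \<le> L * u\<^sup>2" using b[of t] by (intro mult_right_mono) auto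
  finally show ?thesis .
qed simp

text \<open>With \<open>s = tanh\<^sup>2 x\<close>, the second derivative of \<open>tanh\<^sup>2\<close> at \<open>x\<close> is \<open>2 (1 - s) (1 - 3 s)\<close>, and the
  product of the two brackets lies in \<open>[-1/3, 1]\<close> for \<open>0 \<le> s \<le> 1\<close>. The constant \<open>1\<close>, attained at
  \<open>s = 0\<close>, is what turns into the threshold \<open>\<beta>\<^sub>c\<close>.\<close>
lemma tanh_square_taylor:
  fixes a u :: real
  shows "\<bar>(tanh (a + u))\<^sup>2 - (tanh a)\<^sup>2 - 2 * tanh a * (1 - (tanh a)\<^sup>2) * u\<bar> \<le> u\<^sup>2"
proof -
  have "\<bar>(tanh (a + u))\<^sup>2 - (tanh a)\<^sup>2 - (2 * tanh a * (1 - (tanh a)\<^sup>2)) * u\<bar> \<le> 1 * u\<^sup>2"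
  proof (rule taylor_quadratic_bound)
    fix x :: real
    show "((\<lambda>x. (tanh x)\<^sup>2) has_real_derivative 2 * tanh x * (1 - (tanh x)\<^sup>2)) (at x)"
      by (auto intro!: derivative_eq_intros simp: cosh_real_nonzero)
    show "((\<lambda>x. 2 * tanh x * (1 - (tanh x)\<^sup>2)) has_real_derivative
        2 * ((1 - (tanh x)\<^sup>2) * (1 - 3 * (tanh x)\<^sup>2))) (at x)"
      by (rule derivative_eq_intros refl | simp add: cosh_real_nonzero)+
        (simp add: algebra_simps power2_eq_square)
    define s where "s = (tanh x)\<^sup>2"
    have "0 \<le> s" "s \<le> 1" using tanh_real_bounds[of x] by (auto simp: s_def abs_square_le_1)
    then have "\<bar>1 - s\<bar> * \<bar>1 - 3 * s\<bar> \<le> 1"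
    proof -
      have "(1 - s) * (1 - 3 * s) = 1 - s * (4 - 3 * s)" by (simp add: algebra_simps)
      moreover have "0 \<le> s * (4 - 3 * s)" using \<open>0 \<le> s\<close> \<open>s \<le> 1\<close> by simp
      moreover have "(1 - s) * (1 - 3 * s) = 3 * (s - 2/3)\<^sup>2 - 1/3"
        by (simp add: power2_eq_square algebra_simps)
      then have "- 1 \<le> (1 - s) * (1 - 3 * s)"
        using zero_le_power2[of "s - 2/3"] by linarith
      ultimately show ?thesis by (simp flip: abs_mult)
    qed
    then show "\<bar>2 * ((1 - (tanh x)\<^sup>2) * (1 - 3 * (tanh x)\<^sup>2))\<bar> \<le> 2 * 1"
      by (simp add: s_def abs_mult)
  qed
  then show ?thesis by simp
qed

section \<open>Existence and uniqueness of the critical point\<close>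

theorem theorem1p4:
  fixes m :: nat
    and Dsq :: "real mat" and lam :: "nat \<Rightarrow> real"
    and \<beta> h :: real
    and M :: "'a measure" and eta :: "'a \<Rightarrow> real"
  assumes "m \<ge> 2"
    and "Dsq \<in> carrier_mat m m"
    and "transpose_mat Dsq = Dsq"
    and "invertible_mat Dsq"
    and "Dsq \<noteq> 0\<^sub>m m m"
    and "\<And>s t. s < m \<Longrightarrow> t < m \<Longrightarrow> Dsq $$ (s, t) \<ge> 0"
    and "\<And>s. s < m \<Longrightarrow> 0 < lam s \<and> lam s < 1"
    and "(\<Sum>s<m. lam s) = 1"
    and "prob_space M"
    and "distributed M lborel eta std_normal_density"
    and "\<beta> > 0" and "h \<ge> 0"
    and "\<beta> < beta_c m Dsq lam"
  shows "is_singleton (crit_points m M eta Dsq lam \<beta> h)"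
proof -
  note Dsq = assms(2) and eta = assms(10) and \<beta> = assms(11)
  \<comment> \<open>The factor \<open>\<beta>\<close> is absorbed into the variance, \<open>\<beta> \<surd>v = \<surd>(\<beta>\<^sup>2 v)\<close>, so that the Lipschitz
    constant of \<open>G\<close> is \<open>1\<close> and the whole smallness condition sits in \<open>B\<close>.\<close>
  define A where "A = Dsq * mat_diag m lam"
  define B where "B = \<beta>\<^sup>2 \<cdot>\<^sub>m A"
  define G where "G x = (\<integral>z. (tanh (sqrt x * z + h))\<^sup>2 \<partial>std_normal)" for x
  define F where "F q = vec m (\<lambda>s. G ((B *\<^sub>v q) $ s))" for q
  have m: "m > 0" using assms(1) by simp
  have A: "A \<in> carrier_mat m m" using Dsq by (simp add: A_def)
  have B: "B \<in> carrier_mat m m" using A by (simp add: B_def)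
  have A_nonneg: "0 \<le> A $$ (s, t)" if "s < m" "t < m" for s t
    using that Dsq assms(6)[OF that] assms(7)[of t] by (simp add: A_def mat_diag_mult_right)
  then have B_nonneg: "0 \<le> B $$ (s, t)" if "s < m" "t < m" for s t
    using that A by (simp add: B_def)
  have sr: "spectral_radius (map_mat complex_of_real B) < 1"
  proof -
    define r where "r = spectral_radius (map_mat complex_of_real A)"
    have A': "map_mat complex_of_real A \<in> carrier_mat m m" using A by simp
    have "0 \<le> r" using spectral_radius_mem_max(1)[OF A' m] by (auto simp: r_def)
    have less: "\<beta> < r powr (- 1 / 2)"
      using assms(13) by (simp add: beta_c_def A_def r_def)
    \<comment> \<open>If \<open>r = 0\<close>, then \<open>beta_c\<close> has the value \<open>0\<close> instead of infinity, since \<open>0 powr a = 0\<close>;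
      so \<open>0 < \<beta> < beta_c\<close> excludes this case.\<close>
    with \<beta> \<open>0 \<le> r\<close> have r: "r > 0" by (cases "r = 0") auto
    have "\<beta>\<^sup>2 < (r powr (- 1 / 2))\<^sup>2" using less \<beta> by (intro power_strict_mono) auto
    also have "\<dots> = inverse r" using r
      by (simp add: powr_minus powr_half_sqrt power_inverse flip: minus_divide_left)
    finally have "\<beta>\<^sup>2 * r < 1" using r by (simp add: field_simps)
    moreover have "map_mat complex_of_real B = complex_of_real (\<beta>\<^sup>2) \<cdot>\<^sub>m map_mat complex_of_real A"
      by (rule eq_matI) (auto simp: B_def)
    moreover have "spectral_radius (complex_of_real (\<beta>\<^sup>2) \<cdot>\<^sub>m map_mat complex_of_real A)
        \<le> norm (complex_of_real (\<beta>\<^sup>2)) * r"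
      unfolding r_def using \<beta> by (intro spectral_radius_smult_le[OF A' m]) simp
    ultimately show ?thesis by (simp only: norm_of_real) simp
  qed
  have tanh_sq_le: "(tanh x)\<^sup>2 \<le> 1" for x :: real
    using tanh_real_bounds[of x] by (auto simp: abs_square_le_1)
  have meas [measurable]: "(\<lambda>x::real. (tanh x)\<^sup>2) \<in> borel_measurable borel"
    by (intro borel_measurable_continuous_onI continuous_intros) (simp add: cosh_real_nonzero)
  have G_bounds: "G x \<in> {0..1}" for x
  proof -
    have "G x \<le> (\<integral>z. 1 \<partial>std_normal)" unfolding G_def
      by (intro integral_mono std_normal.integrable_const_bound[of _ 1]) (auto simp: tanh_sq_le)
    then show ?thesis using std_normal.prob_space by (simp add: G_def)
  qed
  have G_lip: "\<bar>G x - G y\<bar> \<le> \<bar>x - y\<bar>" if "0 \<le> x" "0 \<le> y" for x y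
    unfolding G_def
    using gaussian_smoothing_lipschitz_variance[of "\<lambda>x. (tanh x)\<^sup>2" 1 "\<lambda>a. 2 * tanh a * (1 - (tanh a)\<^sup>2)" 1 x y h]
      that tanh_square_taylor by (simp add: tanh_sq_le)
  have Bq: "(B *\<^sub>v q) $ s = (\<Sum>t<m. B $$ (s, t) * q $ t)" if "q \<in> carrier_vec m" "s < m" for q s
    using that B by (auto simp: scalar_prod_def atLeast0LessThan)
  have Bq_nonneg: "0 \<le> (B *\<^sub>v q) $ s" if "q \<in> unit_cube m" "s < m" for q s
    using that by (subst Bq) (auto simp: unit_cube_def intro!: sum_nonneg mult_nonneg_nonneg B_nonneg)
  have "\<exists>!q. q \<in> unit_cube m \<and> F q = q"
  proof (rule ex1_fixpoint_unit_cube[OF B m B_nonneg sr])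
    show "F q \<in> unit_cube m" for q
      using G_bounds by (simp add: F_def unit_cube_def)
    fix p q :: "real vec" and s
    assume pq: "p \<in> unit_cube m" "q \<in> unit_cube m" and s: "s < m"
    then have "\<bar>F p $ s - F q $ s\<bar> \<le> \<bar>(B *\<^sub>v p) $ s - (B *\<^sub>v q) $ s\<bar>"
      using G_lip Bq_nonneg by (simp add: F_def)
    also have "\<dots> = \<bar>\<Sum>t<m. B $$ (s, t) * (p $ t - q $ t)\<bar>"
      using pq s by (simp add: Bq unit_cube_def right_diff_distrib sum_subtractf)
    also have "\<dots> \<le> (\<Sum>t<m. B $$ (s, t) * \<bar>p $ t - q $ t\<bar>)"
      using B_nonneg s by (intro order_trans[OF sum_abs] sum_mono) (auto simp: abs_mult)
    finally show "\<bar>F p $ s - F q $ s\<bar> \<le> (\<Sum>t<m. B $$ (s, t) * \<bar>p $ t - q $ t\<bar>)" .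
  qed
  moreover have "crit_points m M eta Dsq lam \<beta> h = {q \<in> unit_cube m. F q = q}"
  proof -
    have expectation: "(\<integral>\<omega>. (tanh (\<beta> * eta \<omega> * sqrt ((A *\<^sub>v q) $ s) + h))\<^sup>2 \<partial>M) = G ((B *\<^sub>v q) $ s)"
      if q: "q \<in> carrier_vec m" and s: "s < m" for q s
    proof -
      have "(B *\<^sub>v q) $ s = \<beta>\<^sup>2 * (A *\<^sub>v q) $ s"
        using q s A by (simp add: B_def smult_mat_mult_vec[OF A])
      then have "sqrt ((B *\<^sub>v q) $ s) = \<beta> * sqrt ((A *\<^sub>v q) $ s)"
        using \<beta> by (simp add: real_sqrt_mult)
      then show ?thesis
        using distributed_integral[OF eta, of "\<lambda>z. (tanh (sqrt ((B *\<^sub>v q) $ s) * z + h))\<^sup>2"]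
        by (simp add: G_def integral_density ac_simps)
    qed
    have "F q = q \<longleftrightarrow> (\<forall>s<m. q $ s = G ((B *\<^sub>v q) $ s))" if "q \<in> carrier_vec m" for q
      using that by (auto simp: F_def vec_eq_iff)
    then show ?thesis
      using expectation by (auto simp: crit_points_def unit_cube_def A_def[symmetric])
  qed
  ultimately show ?thesis
    by (auto simp: is_singleton_def)
qed

end
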